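(* Let $(\mathfrak{g},[\cdot,\cdot]_{\mathfrak{g}})$ be a Leibniz algebra. Then the omni-cohomology of $\mathfrak{g}$ with coefficients in the adjoint omni-representation $\mathfrak{ad}=\mathrm{ad}_L+\mathrm{id}:\mathfrak{g}\to\mathfrak{gl}(\mathfrak{g})\oplus\mathfrak{g}$ and the Loday-Pirashvili cohomology of $\mathfrak{g}$ with coefficients in the adjoint representation $(\mathfrak{g},\mathrm{ad}_L,\mathrm{ad}_R)$ agree (are isomorphic): $$H^\bullet_{omni}(\mathfrak{g};\mathfrak{ad})=H^\bullet(\mathfrak{g};\mathrm{ad}_L,\mathrm{ad}_R).$$
   Context: All vector spaces are over $\mathbb{R}$. A Leibniz algebra is a vector space $\mathfrak{g}$ with a bilinear bracket $[\cdot,\cdot]_{\mathfrak{g}}$ satisfying $[x,[y,z]_{\mathfrak{g}}]_{\mathfrak{g}}=[[x,y]_{\mathfrak{g}},z]_{\mathfrak{g}}+[y,[x,z]_{\mathfrak{g}}]_{\mathfrak{g}}$. Loday-Pirashvili cohomology. A representation of $\mathfrak{g}$ is a triple $(V,l,r)$ with $l,r:\mathfrak{g}\to\mathfrak{gl}(V)$ linear, $l_{[x,y]_{\mathfrak{g}}}=[l_x,l_y]$, $r_{[x,y]_{\mathfrak{g}}}=[l_x,r_y]$, $r_y\circ l_x=-r_y\circ r_x$. Its cohomology $H^\bullet(\mathfrak{g};l,r)$ is that of the complex $C^k(\mathfrak{g},V)=\mathrm{Hom}(\otimes^k\mathfrak{g},V)$, $k\ge 0$, with $$\partial c^k(x_1,\dots,x_{k+1})=\sum_{i=1}^k(-1)^{i+1}l_{x_i}(c^k(x_1,\dots,\widehat{x_i},\dots,x_{k+1}))+(-1)^{k+1}r_{x_{k+1}}(c^k(x_1,\dots,x_k))$$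 $$+\sum_{1\le i<j\le k+1}(-1)^ic^k(x_1,\dots,\widehat{x_i},\dots,x_{j-1},[x_i,x_j]_{\mathfrak{g}},x_{j+1},\dots,x_{k+1}).$$ The adjoint representation is $(\mathfrak{g},\mathrm{ad}_L,\mathrm{ad}_R)$ with $\mathrm{ad}_L(x)(y)=[x,y]_{\mathfrak{g}}$, $\mathrm{ad}_R(x)(y)=[y,x]_{\mathfrak{g}}$; its cohomology is $H^\bullet(\mathfrak{g};\mathrm{ad}_L,\mathrm{ad}_R)$. Omni-cohomology. For a vector space $V$, $\mathfrak{ol}(V)=\mathfrak{gl}(V)\oplus V$ is the Leibniz algebra with bracket $\{A+u,B+v\}=[A,B]+Av$. An omni-representation of $\mathfrak{g}$ on $V$ is a Leibniz algebra homomorphism $\rho:\mathfrak{g}\to\mathfrak{ol}(V)$. Its omni-cohomology $H^\bullet_{omni}(\mathfrak{g};\rho)$ is the cohomology of the complex $C^k(\mathfrak{g};\rho)=\mathrm{Hom}(\otimes^k\mathfrak{g},\mathrm{im}(\rho))$, $k\ge0$, with $$\delta c^k(x_1,\dots,x_{k+1})=\sum_{i=1}^k(-1)^{i+1}\{\rho(x_i),c^k(x_1,\dots,\widehat{x_i},\dots,x_{k+1})\}+(-1)^{k+1}\{c^k(x_1,\dots,x_k),\rho(x_{k+1})\}$$ $$+\sum_{1\le i<j\le k+1}(-1)^ic^k(x_1,\dots,\widehat{x_i},\dots,x_{j-1},[x_i,x_j]_{\mathfrak{g}},x_{j+1},\dots,x_{k+1}).$$ The adjoint omni-representation is the homomorphism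 $\mathfrak{ad}:\mathfrak{g}\to\mathfrak{gl}(\mathfrak{g})\oplus\mathfrak{g}$, $\mathfrak{ad}(x)=\mathrm{ad}_L(x)+x$. A $k$-cochain $f\in C^k(\mathfrak{g};\mathfrak{ad})$ is identified with the unique linear map $\mathfrak{f}:\otimes^k\mathfrak{g}\to\mathfrak{g}$ such that $f=\mathrm{ad}_L\circ\mathfrak{f}+\mathfrak{f}$. *)

theory Defs
  imports "HOL-Analysis.Analysis" "HOL-Library.Function_Algebras"
begin

section \<open>Pointwise vector space structure on functions\<close>

instantiation "fun" :: (type, real_vector) real_vector
begin

definition scaleR_fun :: "real \<Rightarrow> ('a \<Rightarrow> 'b) \<Rightarrow> 'a \<Rightarrow> 'b" where
  "scaleR_fun r f = (\<lambda>x. r *\<^sub>R f x)"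

instance
  by standard (auto simp: scaleR_fun_def fun_eq_iff algebra_simps)

end

lemma scaleR_fun_apply [simp]: "(r *\<^sub>R f) x = r *\<^sub>R f x"
  by (simp add: scaleR_fun_def)


section \<open>The vector space \<open>gl(V)\<close>\<close>

typedef (overloaded) ('v::real_vector) gl = "{A :: 'v \<Rightarrow> 'v. linear A}"
  morphisms app Abs_gl
  using linear_id by blast

setup_lifting type_definition_gl

instantiation gl :: (real_vector) real_vector
begin

lift_definition zero_gl :: "'a gl" is "\<lambda>_. 0"
  by (simp add: linear_iff)

lift_definition plus_gl :: "'a gl \<Rightarrow> 'a gl \<Rightarrow> 'a gl" is "\<lambda>A B v. A v + B v"
  by (rule linear_compose_add)

lift_definition minus_gl :: "'a gl \<Rightarrow> 'a gl \<Rightarrow> 'a gl" is "\<lambda>A B v. A v - B v"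
  by (rule linear_compose_sub)

lift_definition uminus_gl :: "'a gl \<Rightarrow> 'a gl" is "\<lambda>A v. - A v"
  by (rule linear_compose_neg)

lift_definition scaleR_gl :: "real \<Rightarrow> 'a gl \<Rightarrow> 'a gl" is "\<lambda>r A v. r *\<^sub>R A v"
  by (rule linear_compose_scale_right)

instance
  by standard (transfer, simp add: algebra_simps)+

end

lift_definition gl_comp :: "'v::real_vector gl \<Rightarrow> 'v gl \<Rightarrow> 'v gl" is "\<lambda>A B v. A (B v)"
  using linear_compose[unfolded o_def] by blast

definition gl_bracket :: "'v::real_vector gl \<Rightarrow> 'v gl \<Rightarrow> 'v gl" where
  "gl_bracket A B = gl_comp A B - gl_comp B A"


section \<open>Leibniz algebras, representations and omni-representations\<close>

definition leibniz_algebra :: "('g::real_vector \<Rightarrow> 'g \<Rightarrow> 'g) \<Rightarrow> bool" where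
  "leibniz_algebra br \<longleftrightarrow>
     bilinear br \<and> (\<forall>x y z. br x (br y z) = br (br x y) z + br y (br x z))"

definition leibniz_hom ::
    "('g::real_vector \<Rightarrow> 'g \<Rightarrow> 'g) \<Rightarrow> ('h::real_vector \<Rightarrow> 'h \<Rightarrow> 'h) \<Rightarrow> ('g \<Rightarrow> 'h) \<Rightarrow> bool" where
  "leibniz_hom br br' \<rho> \<longleftrightarrow> linear \<rho> \<and> (\<forall>x y. \<rho> (br x y) = br' (\<rho> x) (\<rho> y))"

definition leibniz_rep ::
    "('g::real_vector \<Rightarrow> 'g \<Rightarrow> 'g) \<Rightarrow> ('g \<Rightarrow> 'v::real_vector gl) \<Rightarrow> ('g \<Rightarrow> 'v gl) \<Rightarrow> bool" where
  "leibniz_rep br l r \<longleftrightarrow> linear l \<and> linear r \<and>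
     (\<forall>x y. l (br x y) = gl_bracket (l x) (l y)) \<and>
     (\<forall>x y. r (br x y) = gl_bracket (l x) (r y)) \<and>
     (\<forall>x y. gl_comp (r y) (l x) = - gl_comp (r y) (r x))"

definition omni_bracket ::
    "'v::real_vector gl \<times> 'v \<Rightarrow> 'v gl \<times> 'v \<Rightarrow> 'v gl \<times> 'v" where
  "omni_bracket a b = (gl_bracket (fst a) (fst b), app (fst a) (snd b))"

definition omni_rep ::
    "('g::real_vector \<Rightarrow> 'g \<Rightarrow> 'g) \<Rightarrow> ('g \<Rightarrow> 'v::real_vector gl \<times> 'v) \<Rightarrow> bool" where
  "omni_rep br \<rho> \<longleftrightarrow> leibniz_hom br omni_bracket \<rho>"

text \<open>For a bilinear bracket, \<open>ad_L\<close> and \<open>ad_R\<close> satisfy \<open>app (ad_L br x) y = br x y\<close> and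
  \<open>app (ad_R br x) y = br y x\<close>.\<close>

definition ad_L :: "('g::real_vector \<Rightarrow> 'g \<Rightarrow> 'g) \<Rightarrow> 'g \<Rightarrow> 'g gl" where
  "ad_L br x = Abs_gl (\<lambda>y. br x y)"

definition ad_R :: "('g::real_vector \<Rightarrow> 'g \<Rightarrow> 'g) \<Rightarrow> 'g \<Rightarrow> 'g gl" where
  "ad_R br x = Abs_gl (\<lambda>y. br y x)"

definition ad_omni :: "('g::real_vector \<Rightarrow> 'g \<Rightarrow> 'g) \<Rightarrow> 'g \<Rightarrow> 'g gl \<times> 'g" where
  "ad_omni br x = (ad_L br x, x)"

lemma app_ad_L: "leibniz_algebra br \<Longrightarrow> app (ad_L br x) y = br x y"
  by (simp add: ad_L_def leibniz_algebra_def bilinear_def Abs_gl_inverse)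

lemma app_ad_R: "leibniz_algebra br \<Longrightarrow> app (ad_R br x) y = br y x"
  by (simp add: ad_R_def leibniz_algebra_def bilinear_def Abs_gl_inverse)

lemma gl_eqI: "(\<And>v. app A v = app B v) \<Longrightarrow> A = B"
  by transfer auto

lemma app_simps [simp]:
  "app (A + B) v = app A v + app B v"
  "app (A - B) v = app A v - app B v"
  "app (- A) v = - app A v"
  "app (r *\<^sub>R A) v = r *\<^sub>R app A v"
  "app 0 v = 0"
  "app (gl_comp A B) v = app A (app B v)"
  by (transfer, simp)+

lemma app_gl_bracket [simp]:
  "app (gl_bracket A B) v = app A (app B v) - app B (app A v)"
  by (simp add: gl_bracket_def)

lemma linear_app: "linear (app A)"
  using app by blast

lemma leibniz_algebra_omni_bracket:
  "leibniz_algebra (omni_bracket :: 'v::real_vector gl \<times> 'v \<Rightarrow> _)"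
proof -
  have app_add: "app A (u + v) = app A u + app A v"
    and app_diff: "app A (u - v) = app A u - app A v"
    and app_scale: "app A (a *\<^sub>R u) = a *\<^sub>R app A u" for A :: "'v gl" and u v a
    using linear_app[of A] by (simp_all add: linear_add linear_diff linear_scale)
  show ?thesis
    unfolding leibniz_algebra_def bilinear_def linear_iff
    by (intro conjI allI prod_eqI gl_eqI)
      (simp_all only: omni_bracket_def fst_conv snd_conv fst_add snd_add fst_scaleR snd_scaleR
        app_simps app_gl_bracket app_add app_diff app_scale scaleR_diff_right,
       simp_all only: algebra_simps)
qed

lemma leibniz_rep_adjoint:
  fixes br :: "'a::real_vector \<Rightarrow> 'a \<Rightarrow> 'a"
  assumes "leibniz_algebra br"
  shows "leibniz_rep br (ad_L br) (ad_R br)"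
proof -
  have b: "bilinear br" and L: "br x (br y z) = br (br x y) z + br y (br x z)" for x y z
    using assms unfolding leibniz_algebra_def by blast+
  have sk: "br (br x z) y = - br (br z x) y" for x y z
  proof -
    have cancel: "a = - d" if "p = a + q" "q = d + p" for a d p q :: 'a
      using that by (metis add.assoc add_cancel_left_left eq_neg_iff_add_eq_0)
    show ?thesis
      by (rule cancel[OF L[of x z y] L[of z x y]])
  qed
  have l: "br (br x y) z = br x (br y z) - br y (br x z)" for x y z
    by (rule eq_diff_eq[THEN iffD2, OF L[symmetric]])
  have r: "br z (br x y) = br x (br z y) - br (br x z) y" for x y z
    using L[of x z y] by (metis add_diff_cancel_left')
  note app = app_ad_L[OF assms] app_ad_R[OF assms]
  show ?thesis
    unfolding leibniz_rep_def
  proof (intro conjI allI)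
    show "linear (ad_L br)" "linear (ad_R br)"
      unfolding linear_iff
      by (auto intro!: gl_eqI simp: app bilinear_ladd[OF b] bilinear_radd[OF b]
          bilinear_lmul[OF b] bilinear_rmul[OF b])
  next
    fix x y
    show "ad_L br (br x y) = gl_bracket (ad_L br x) (ad_L br y)"
      by (rule gl_eqI, simp only: app app_gl_bracket, rule l)
    show "ad_R br (br x y) = gl_bracket (ad_L br x) (ad_R br y)"
      by (rule gl_eqI, simp only: app app_gl_bracket, rule r)
    show "gl_comp (ad_R br y) (ad_L br x) = - gl_comp (ad_R br y) (ad_R br x)"
    proof (rule gl_eqI)
      fix v
      show "app (gl_comp (ad_R br y) (ad_L br x)) v = app (- gl_comp (ad_R br y) (ad_R br x)) v"
        by (simp only: app app_simps, rule sk)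
    qed
  qed
qed

lemma omni_rep_ad_omni:
  assumes "leibniz_algebra br"
  shows "omni_rep br (ad_omni br)"
  using leibniz_rep_adjoint[OF assms]
  by (auto simp: omni_rep_def leibniz_hom_def leibniz_rep_def ad_omni_def omni_bracket_def
      linear_iff app_ad_L[OF assms])


section \<open>Cochains and coboundaries\<close>

text \<open>Linear maps \<open>\<otimes>\<^sup>k g \<rightarrow> W\<close> are encoded, through the universal property of the tensor
  product, as \<open>k\<close>-multilinear maps with values in the subspace \<open>W\<close>. Such a map takes the list
  of its \<open>k\<close> arguments; it is normalised to \<open>0\<close> on lists of any other length, so that equality
  of cochains is equality of functions and the vector space operations are the pointwise ones.
  For \<open>k = 0\<close> a cochain is an element of \<open>W\<close>, its value on the empty list.\<close>

definition cochains :: "'w::real_vector set \<Rightarrow> nat \<Rightarrow> ('g::real_vector list \<Rightarrow> 'w) set" where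
  "cochains W k = {c.
     (\<forall>xs. length xs \<noteq> k \<longrightarrow> c xs = 0) \<and>
     (\<forall>xs. length xs = k \<longrightarrow> c xs \<in> W) \<and>
     (\<forall>xs i. length xs = k \<longrightarrow> i < k \<longrightarrow> linear (\<lambda>x. c (xs[i := x])))}"

text \<open>Arguments are numbered from \<open>1\<close>: \<open>nth_arg i [x\<^sub>1, \<dots>, x\<^sub>n] = x\<^sub>i\<close>, and \<open>omit i\<close> drops \<open>x\<^sub>i\<close>.\<close>

definition nth_arg :: "nat \<Rightarrow> 'g list \<Rightarrow> 'g" where
  "nth_arg i xs = xs ! (i - 1)"

definition omit :: "nat \<Rightarrow> 'g list \<Rightarrow> 'g list" where
  "omit i xs = take (i - 1) xs @ drop i xs"

definition subst_arg :: "nat \<Rightarrow> 'g \<Rightarrow> 'g list \<Rightarrow> 'g list" where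
  "subst_arg j y xs = xs[j - 1 := y]"

text \<open>Both coboundary operators have the following shape, with left action \<open>L x\<close> and right
  action \<open>R x\<close> of \<open>x\<close> on the values of cochains.\<close>

definition coboundary ::
    "('g::real_vector \<Rightarrow> 'g \<Rightarrow> 'g) \<Rightarrow> ('g \<Rightarrow> 'w::real_vector \<Rightarrow> 'w) \<Rightarrow> ('g \<Rightarrow> 'w \<Rightarrow> 'w) \<Rightarrow>
     nat \<Rightarrow> ('g list \<Rightarrow> 'w) \<Rightarrow> ('g list \<Rightarrow> 'w)" where
  "coboundary br L R k c = (\<lambda>xs.
     if length xs = k + 1 then
       (\<Sum>i = 1..k. (-1) ^ (i + 1) *\<^sub>R L (nth_arg i xs) (c (omit i xs)))
       + (-1) ^ (k + 1) *\<^sub>R R (nth_arg (k + 1) xs) (c (omit (k + 1) xs))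
       + (\<Sum>j = 1..k + 1. \<Sum>i = 1..<j.
            (-1) ^ i *\<^sub>R c (omit i (subst_arg j (br (nth_arg i xs) (nth_arg j xs)) xs)))
     else 0)"

definition LP_coboundary ::
    "('g::real_vector \<Rightarrow> 'g \<Rightarrow> 'g) \<Rightarrow> ('g \<Rightarrow> 'v::real_vector gl) \<Rightarrow> ('g \<Rightarrow> 'v gl) \<Rightarrow>
     nat \<Rightarrow> ('g list \<Rightarrow> 'v) \<Rightarrow> ('g list \<Rightarrow> 'v)" where
  "LP_coboundary br l r = coboundary br (\<lambda>x v. app (l x) v) (\<lambda>x v. app (r x) v)"

definition omni_coboundary ::
    "('g::real_vector \<Rightarrow> 'g \<Rightarrow> 'g) \<Rightarrow> ('g \<Rightarrow> 'v::real_vector gl \<times> 'v) \<Rightarrow>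
     nat \<Rightarrow> ('g list \<Rightarrow> 'v gl \<times> 'v) \<Rightarrow> ('g list \<Rightarrow> 'v gl \<times> 'v)" where
  "omni_coboundary br \<rho> =
     coboundary br (\<lambda>x w. omni_bracket (\<rho> x) w) (\<lambda>x w. omni_bracket w (\<rho> x))"


section \<open>Quotient spaces and cohomology\<close>

record 'c vspace =
  vcarrier :: "'c set"
  vadd :: "'c \<Rightarrow> 'c \<Rightarrow> 'c"
  vscale :: "real \<Rightarrow> 'c \<Rightarrow> 'c"

definition vspace_iso :: "('c, 'm) vspace_scheme \<Rightarrow> ('d, 'n) vspace_scheme \<Rightarrow> bool" where
  "vspace_iso S T \<longleftrightarrow> (\<exists>\<phi>. bij_betw \<phi> (vcarrier S) (vcarrier T) \<and>
     (\<forall>x \<in> vcarrier S. \<forall>y \<in> vcarrier S. \<phi> (vadd S x y) = vadd T (\<phi> x) (\<phi> y)) \<and>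
     (\<forall>a. \<forall>x \<in> vcarrier S. \<phi> (vscale S a x) = vscale T a (\<phi> x)))"

definition coset :: "'c::real_vector set \<Rightarrow> 'c \<Rightarrow> 'c set" where
  "coset B z = {z + b | b. b \<in> B}"

text \<open>In the scalar multiple of a coset, adding \<open>B\<close> matters only for the scalar \<open>0\<close>.\<close>

definition quotient_space :: "'c::real_vector set \<Rightarrow> 'c set \<Rightarrow> 'c set vspace" where
  "quotient_space Z B =
     \<lparr> vcarrier = coset B ` Z,
       vadd = (\<lambda>X Y. {x + y | x y. x \<in> X \<and> y \<in> Y}),
       vscale = (\<lambda>a X. {a *\<^sub>R x + b | x b. x \<in> X \<and> b \<in> B}) \<rparr>"

lemma vadd_coset:
  assumes "subspace B"
  shows "vadd (quotient_space Z B) (coset B x) (coset B y) = coset B (x + y)"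
proof (intro equalityI subsetI)
  fix v
  assume "v \<in> vadd (quotient_space Z B) (coset B x) (coset B y)"
  then obtain b1 b2 where b: "b1 \<in> B" "b2 \<in> B" and v: "v = (x + b1) + (y + b2)"
    by (auto simp: quotient_space_def coset_def)
  have "v = (x + y) + (b1 + b2)"
    by (simp add: v)
  then show "v \<in> coset B (x + y)"
    using subspace_add[OF assms b] unfolding coset_def by blast
next
  fix v
  assume "v \<in> coset B (x + y)"
  then obtain b where "b \<in> B" "v = (x + b) + (y + 0)"
    by (auto simp: coset_def)
  then show "v \<in> vadd (quotient_space Z B) (coset B x) (coset B y)"
    using subspace_0[OF assms] unfolding quotient_space_def coset_def vspace.simps by blast
qed

lemma vscale_coset:
  assumes "subspace B"
  shows "vscale (quotient_space Z B) a (coset B x) = coset B (a *\<^sub>R x)"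
proof (intro equalityI subsetI)
  fix v
  assume "v \<in> vscale (quotient_space Z B) a (coset B x)"
  then obtain b1 b2 where b: "b1 \<in> B" "b2 \<in> B" and v: "v = a *\<^sub>R (x + b1) + b2"
    by (auto simp: quotient_space_def coset_def)
  have "v = a *\<^sub>R x + (a *\<^sub>R b1 + b2)"
    by (simp add: v scaleR_add_right)
  then show "v \<in> coset B (a *\<^sub>R x)"
    using subspace_add[OF assms subspace_scale[OF assms b(1)] b(2)] unfolding coset_def by blast
next
  fix v
  assume "v \<in> coset B (a *\<^sub>R x)"
  then obtain b where "b \<in> B" "v = a *\<^sub>R (x + 0) + b"
    by (auto simp: coset_def)
  then show "v \<in> vscale (quotient_space Z B) a (coset B x)"
    using subspace_0[OF assms] unfolding quotient_space_def coset_def vspace.simps by blast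
qed

definition cohomology ::
    "(nat \<Rightarrow> 'c::real_vector set) \<Rightarrow> (nat \<Rightarrow> 'c \<Rightarrow> 'c) \<Rightarrow> nat \<Rightarrow> 'c set vspace" where
  "cohomology C d k =
     quotient_space {c \<in> C k. d k c = 0} (case k of 0 \<Rightarrow> {0} | Suc m \<Rightarrow> d m ` C m)"

definition LP_cohomology ::
    "('g::real_vector \<Rightarrow> 'g \<Rightarrow> 'g) \<Rightarrow> ('g \<Rightarrow> 'v::real_vector gl) \<Rightarrow> ('g \<Rightarrow> 'v gl) \<Rightarrow>
     nat \<Rightarrow> ('g list \<Rightarrow> 'v) set vspace" where
  "LP_cohomology br l r = cohomology (cochains UNIV) (LP_coboundary br l r)"

definition omni_cohomology ::
    "('g::real_vector \<Rightarrow> 'g \<Rightarrow> 'g) \<Rightarrow> ('g \<Rightarrow> 'v::real_vector gl \<times> 'v) \<Rightarrow>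
     nat \<Rightarrow> ('g list \<Rightarrow> 'v gl \<times> 'v) set vspace" where
  "omni_cohomology br \<rho> = cohomology (cochains (range \<rho>)) (omni_coboundary br \<rho>)"

end

theory Submission
  imports Defs
begin

text \<open>
  The adjoint omni-representation is an injective homomorphism of Leibniz algebras, since its
  second component is the identity. Now let \<open>\<rho>\<close> be any injective omni-representation. It
  identifies \<open>\<gg>\<close> with the Leibniz subalgebra \<open>im \<rho>\<close>, in which the omni-cochains take
  their values. Being a homomorphism, it turns the actions \<open>v \<mapsto> [x, v]\<close> and \<open>v \<mapsto> [v, x]\<close>
  of the adjoint representation into the brackets \<open>w \<mapsto> {\<rho> x, w}\<close> and \<open>w \<mapsto> {w, \<rho> x}\<close>.
  Hence \<open>c \<mapsto> \<rho> \<circ> c\<close> is an isomorphism already at the level of complexes: it is a bijection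
  onto the omni-cochains (\<open>cochains_range\<close>) and commutes with the coboundaries
  (\<open>coboundary_comp\<close>). For \<open>\<rho> = \<aa>\<dd>\<close> it is the identification
  \<open>f = ad\<^sub>L \<circ> \<ff> + \<ff>\<close> of an omni-cochain with a map into \<open>\<gg>\<close>.

  An isomorphism of complexes induces one in cohomology (\<open>cohomology_iso\<close>). Postcomposition
  with \<open>\<rho>\<close> is linear and injective on arbitrary functions, not only on cochains. Therefore taking
  images under it is injective on all sets of functions, so the induced map on cosets
  can be treated as a map of sets, without choosing representatives.
\<close>

text \<open>Addition and scaling of cosets are the operations on sets induced by those on elements, so
  taking images under \<open>\<psi>\<close> commutes with them for arbitrary sets. The isomorphism is its left
  inverse, the preimage map: on \<open>\<psi> ` X\<close> and \<open>\<psi> ` Y\<close> both sides of additivity reduce to the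
  same set without asking whether the sum lies in the carrier.\<close>

lemma quotient_space_iso_image:
  assumes "linear \<psi>" and inj: "inj \<psi>"
  shows "vspace_iso (quotient_space (\<psi> ` Z) (\<psi> ` B)) (quotient_space Z B)"
proof -
  let ?S = "quotient_space (\<psi> ` Z) (\<psi> ` B)" and ?T = "quotient_space Z B"
  interpret linear \<psi> by fact
  have vimage: "\<psi> -` (\<psi> ` X) = X" for X
    by (rule inj_vimage_image_eq[OF inj])
  have coset: "coset (\<psi> ` B) (\<psi> z) = \<psi> ` coset B z" for z
    by (simp add: coset_def Setcompr_eq_image image_image add)
  have carrier: "vcarrier ?S = (`) \<psi> ` vcarrier ?T"
    by (simp add: quotient_space_def image_image coset)
  have vadd: "vadd ?S (\<psi> ` X) (\<psi> ` Y) = \<psi> ` vadd ?T X Y" for X Y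
  proof -
    have "vadd ?S (\<psi> ` X) (\<psi> ` Y) = {\<psi> x + \<psi> y |x y. x \<in> X \<and> y \<in> Y}"
      unfolding quotient_space_def vspace.simps by blast
    also have "\<dots> = {\<psi> (x + y) |x y. x \<in> X \<and> y \<in> Y}"
      by (simp add: add)
    also have "\<dots> = \<psi> ` vadd ?T X Y"
      unfolding quotient_space_def vspace.simps by blast
    finally show ?thesis .
  qed
  have vscale: "vscale ?S a (\<psi> ` X) = \<psi> ` vscale ?T a X" for a X
  proof -
    have "vscale ?S a (\<psi> ` X) = {a *\<^sub>R \<psi> x + \<psi> b |x b. x \<in> X \<and> b \<in> B}"
      unfolding quotient_space_def vspace.simps by blast
    also have "\<dots> = {\<psi> (a *\<^sub>R x + b) |x b. x \<in> X \<and> b \<in> B}"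
      by (simp add: add scale)
    also have "\<dots> = \<psi> ` vscale ?T a X"
      unfolding quotient_space_def vspace.simps by blast
    finally show ?thesis .
  qed
  have "bij_betw (vimage \<psi>) (vcarrier ?S) (vcarrier ?T)"
    by (rule bij_betw_byWitness[where f' = "(`) \<psi>"]) (auto simp: carrier vimage)
  then show ?thesis
    unfolding vspace_iso_def
    by (intro exI[of _ "vimage \<psi>"]) (auto simp: carrier vimage vadd vscale)
qed

lemma cohomology_iso:
  assumes "linear \<psi>" and inj: "inj \<psi>"
    and C: "\<And>k. C' k = \<psi> ` C k"
    and d: "\<And>k c. d' k (\<psi> c) = \<psi> (d k c)"
  shows "vspace_iso (cohomology C' d' k) (cohomology C d k)"
proof -
  interpret linear \<psi> by fact
  have zero_iff: "\<psi> c = 0 \<longleftrightarrow> c = 0" for c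
    using inj_eq[OF inj, of c 0] by simp
  have cocycles: "{c \<in> C' k. d' k c = 0} = \<psi> ` {c \<in> C k. d k c = 0}"
    by (auto simp: C d zero_iff)
  have coboundaries: "(case k of 0 \<Rightarrow> {0} | Suc m \<Rightarrow> d' m ` C' m)
      = \<psi> ` (case k of 0 \<Rightarrow> {0} | Suc m \<Rightarrow> d m ` C m)"
    by (cases k) (simp_all add: C d image_image)
  show ?thesis
    unfolding cohomology_def cocycles coboundaries
    by (rule quotient_space_iso_image[OF assms(1,2)])
qed

lemma linear_comp_left:
  assumes "linear \<rho>"
  shows "linear (\<lambda>c :: 'a \<Rightarrow> _. \<rho> \<circ> c)"
  using assms by (simp add: linear_iff fun_eq_iff)

lemma inj_comp_left:
  assumes "inj \<rho>"
  shows "inj (\<lambda>c :: 'a \<Rightarrow> _. \<rho> \<circ> c)"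
  using assms by (auto simp: inj_def fun_eq_iff)

lemma linear_of_comp_inj:
  assumes "linear \<rho>" and "inj \<rho>" and "linear (\<lambda>x. \<rho> (h x))"
  shows "linear h"
  using assms by (simp add: linear_iff) (metis injD)

text \<open>A multilinear map into \<open>im \<rho>\<close> factors through \<open>\<rho>\<close>, and by injectivity the factor is again
  multilinear.\<close>

lemma cochains_range:
  assumes "linear \<rho>" and inj: "inj \<rho>"
  shows "cochains (range \<rho>) k = (\<lambda>c. \<rho> \<circ> c) ` cochains UNIV k"
proof (intro equalityI subsetI)
  fix c
  assume "c \<in> (\<lambda>c. \<rho> \<circ> c) ` cochains UNIV k"
  then show "c \<in> cochains (range \<rho>) k"
    using linear_compose[OF _ assms(1)] linear_0[OF assms(1)]
    by (auto simp: cochains_def o_def)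
next
  fix c
  assume c: "c \<in> cochains (range \<rho>) k"
  define b where "b = inv \<rho> \<circ> c"
  have "c xs \<in> range \<rho>" for xs
    using c linear_0[OF assms(1)] by (cases "length xs = k") (auto simp: cochains_def)
  then have \<rho>b: "\<rho> (b xs) = c xs" for xs
    by (simp add: b_def f_inv_into_f)
  have "b xs = 0" if "length xs \<noteq> k" for xs
  proof (rule injD[OF inj])
    show "\<rho> (b xs) = \<rho> 0"
      using c that by (simp add: \<rho>b cochains_def linear_0[OF assms(1)])
  qed
  moreover have "linear (\<lambda>x. b (xs[i := x]))" if "length xs = k" "i < k" for xs i
    using c that by (intro linear_of_comp_inj[OF assms]) (simp add: \<rho>b cochains_def)
  ultimately have "b \<in> cochains UNIV k"
    by (simp add: cochains_def)
  moreover have "c = \<rho> \<circ> b"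
    by (simp add: fun_eq_iff \<rho>b)
  ultimately show "c \<in> (\<lambda>c. \<rho> \<circ> c) ` cochains UNIV k"
    by blast
qed

text \<open>The coboundary is natural in the coefficients: the bracket terms only involve the arguments
  of the cochain, so they are preserved by every linear map, and the action terms
  by every map intertwining the actions.\<close>

lemma coboundary_comp:
  assumes "linear \<rho>"
    and L: "\<And>x v. L' x (\<rho> v) = \<rho> (L x v)"
    and R: "\<And>x v. R' x (\<rho> v) = \<rho> (R x v)"
  shows "coboundary br L' R' k (\<rho> \<circ> c) = \<rho> \<circ> coboundary br L R k c"
proof -
  interpret linear \<rho> by fact
  show ?thesis
    by (simp add: fun_eq_iff coboundary_def L R add sum scale neg diff)
qed

theorem omni_cohomology_iso_adjoint:
  assumes "leibniz_algebra br" and "omni_rep br \<rho>" and inj: "inj \<rho>"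
  shows "vspace_iso (omni_cohomology br \<rho> k) (LP_cohomology br (ad_L br) (ad_R br) k)"
proof -
  have lin: "linear \<rho>" and hom: "\<And>x y. \<rho> (br x y) = omni_bracket (\<rho> x) (\<rho> y)"
    using assms(2) by (auto simp: omni_rep_def leibniz_hom_def)
  show ?thesis
    unfolding omni_cohomology_def LP_cohomology_def
  proof (rule cohomology_iso[OF linear_comp_left[OF lin] inj_comp_left[OF inj]
        cochains_range[OF lin inj]])
    show "omni_coboundary br \<rho> k (\<rho> \<circ> c)
        = \<rho> \<circ> LP_coboundary br (ad_L br) (ad_R br) k c" for k c
      unfolding omni_coboundary_def LP_coboundary_def
      by (rule coboundary_comp[OF lin])
        (simp_all add: hom app_ad_L[OF assms(1)] app_ad_R[OF assms(1)])
  qed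
qed

theorem theorem4p3:
  fixes br :: "'g::real_vector \<Rightarrow> 'g \<Rightarrow> 'g"
  assumes "leibniz_algebra br"
  shows "\<forall>k. vspace_iso (omni_cohomology br (ad_omni br) k)
                        (LP_cohomology br (ad_L br) (ad_R br) k)"
proof -
  have "inj (ad_omni br)"
    by (simp add: inj_def ad_omni_def)
  then show ?thesis
    using omni_cohomology_iso_adjoint[OF assms omni_rep_ad_omni[OF assms]] by blast
qed

end
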